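(* The Conway addition $+$ is a symmetric monoidal closed structure on the category $\mathbf{Game}$ with monoidal unit $1=(\{*\},\to_1=\emptyset)$.
   Context: A game is a pair $\mathbb{X}=(X,\to)$ of a (possibly infinite) set $X$ and a relation ${\to}\subset X\times X$ such that (finite options) for every $x\in X$ the set $\{x'\in X\mid x\to x'\}$ is finite, and (finite time) there is no infinite path $x_0\to x_1\to x_2\to\cdots$. A game morphism $f\colon (X,\to_{\mathbb{X}})\to (Y,\to_{\mathbb{Y}})$ is a function $f\colon X\to Y$ such that (1) $x\to_{\mathbb{X}} x'$ implies $f(x)\to_{\mathbb{Y}} f(x')$, and (2) (path-lifting) if $f(x)\to_{\mathbb{Y}} y$ then there is $x'\in X$ with $x\to_{\mathbb{X}}x'$ and $f(x')=y$. $\mathbf{Game}$ is the category of games and game morphisms. The Conway sum $\mathbb{X}+\mathbb{Y}$ of games $\mathbb{X}=(X,\to_{\mathbb{X}})$ and $\mathbb{Y}=(Y,\to_{\mathbb{Y}})$ is the game with underlying set $X\times Y$ and $(x,y)\to_{\mathbb{X}+\mathbb{Y}}(x',y')$ iff ($x\to_{\mathbb{X}}x'$ and $y=y'$) or ($x=x'$ and $y\to_{\mathbb{Y}}y'$). On morphisms, $+$ acts as the product of the underlying functions, and the structure isomorphisms are those of the cartesian product of sets. *)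

theory Defs
  imports "HOL-Library.FuncSet" "HOL-Library.FSet"
begin

section \<open>The category of games\<close>

text \<open>
  The objects of the category are the games over all types; a morphism may connect games over
  different types.  Morphisms are extensional functions, so that equality of morphisms is
  equality in HOL.
\<close>

record 'a pregame =
  positions :: "'a set"
  moves :: "('a \<times> 'a) set"

definition game :: "'a pregame \<Rightarrow> bool" where
  "game X \<longleftrightarrow>
     moves X \<subseteq> positions X \<times> positions X \<and>
     (\<forall>x\<in>positions X. finite {x'. (x, x') \<in> moves X}) \<and>
     \<not> (\<exists>p :: nat \<Rightarrow> 'a. \<forall>n. (p n, p (Suc n)) \<in> moves X)"

definition game_hom :: "'a pregame \<Rightarrow> 'b pregame \<Rightarrow> ('a \<Rightarrow> 'b) set" where
  "game_hom X Y =
     {f \<in> positions X \<rightarrow>\<^sub>E positions Y.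
        (\<forall>x x'. (x, x') \<in> moves X \<longrightarrow> (f x, f x') \<in> moves Y) \<and>
        (\<forall>x\<in>positions X. \<forall>y. (f x, y) \<in> moves Y \<longrightarrow> (\<exists>x'. (x, x') \<in> moves X \<and> f x' = y))}"

definition game_id :: "'a pregame \<Rightarrow> 'a \<Rightarrow> 'a" where
  "game_id X = restrict (\<lambda>x. x) (positions X)"

text \<open>The annotation in \<open>g \<circ>\<^bsub>X\<^esub> f\<close> is the domain of \<open>f\<close>.\<close>

definition game_comp :: "('b \<Rightarrow> 'c) \<Rightarrow> 'a pregame \<Rightarrow> ('a \<Rightarrow> 'b) \<Rightarrow> 'a \<Rightarrow> 'c"
    ("(_ \<circ>\<^bsub>_\<^esub> _)" [56, 0, 55] 55) where
  "g \<circ>\<^bsub>X\<^esub> f = compose (positions X) g f"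

definition game_iso :: "'a pregame \<Rightarrow> 'b pregame \<Rightarrow> ('a \<Rightarrow> 'b) \<Rightarrow> bool" where
  "game_iso X Y f \<longleftrightarrow>
     f \<in> game_hom X Y \<and>
     (\<exists>g\<in>game_hom Y X. (g \<circ>\<^bsub>X\<^esub> f) = game_id X \<and> (f \<circ>\<^bsub>Y\<^esub> g) = game_id Y)"

lemma game_id_hom: "game X \<Longrightarrow> game_id X \<in> game_hom X X"
  by (auto simp: game_id_def game_hom_def game_def)

lemma game_comp_hom:
  assumes "game X" "f \<in> game_hom X Y" "g \<in> game_hom Y Z"
  shows "(g \<circ>\<^bsub>X\<^esub> f) \<in> game_hom X Z"
proof -
  have mv: "x \<in> positions X \<and> x' \<in> positions X" if "(x, x') \<in> moves X" for x x'
    using that assms(1) by (auto simp: game_def)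
  have fX: "f x \<in> positions Y" if "x \<in> positions X" for x
    using that assms(2) by (auto simp: game_hom_def)
  have gY: "g y \<in> positions Z" if "y \<in> positions Y" for y
    using that assms(3) by (auto simp: game_hom_def)
  have lift: "\<exists>x'. (x, x') \<in> moves X \<and> g (f x') = z"
    if x: "x \<in> positions X" and z: "(g (f x), z) \<in> moves Z" for x z
  proof -
    obtain y where "(f x, y) \<in> moves Y" "g y = z"
      using fX[OF x] z assms(3) unfolding game_hom_def by blast
    then show ?thesis using x assms(2) unfolding game_hom_def by blast
  qed
  show ?thesis
    unfolding game_hom_def
  proof (intro CollectI conjI allI ballI impI)
    show "(g \<circ>\<^bsub>X\<^esub> f) \<in> positions X \<rightarrow>\<^sub>E positions Z"
      using fX gY by (auto simp: game_comp_def compose_def)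
    show "((g \<circ>\<^bsub>X\<^esub> f) x, (g \<circ>\<^bsub>X\<^esub> f) x') \<in> moves Z" if "(x, x') \<in> moves X" for x x'
      using that mv[OF that] assms(2,3) by (simp add: game_comp_def compose_def game_hom_def)
    show "\<exists>x'. (x, x') \<in> moves X \<and> (g \<circ>\<^bsub>X\<^esub> f) x' = z"
      if "x \<in> positions X" "((g \<circ>\<^bsub>X\<^esub> f) x, z) \<in> moves Z" for x z
      using lift[of x z] that mv by (fastforce simp: game_comp_def compose_def)
  qed
qed

lemma game_comp_id:
  assumes "f \<in> game_hom X Y"
  shows "(f \<circ>\<^bsub>X\<^esub> game_id X) = f" and "(game_id Y \<circ>\<^bsub>X\<^esub> f) = f"
  using assms unfolding game_hom_def game_comp_def game_id_def compose_def
  by (auto simp: fun_eq_iff PiE_iff extensional_def)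

lemma game_comp_assoc:
  assumes "f \<in> game_hom X Y"
  shows "(h \<circ>\<^bsub>X\<^esub> (g \<circ>\<^bsub>X\<^esub> f)) = ((h \<circ>\<^bsub>Y\<^esub> g) \<circ>\<^bsub>X\<^esub> f)"
  using assms unfolding game_hom_def game_comp_def compose_def
  by (auto simp: fun_eq_iff PiE_iff)

section \<open>The Conway sum\<close>

definition conway_sum :: "'a pregame \<Rightarrow> 'b pregame \<Rightarrow> ('a \<times> 'b) pregame" (infixr "\<boxplus>" 65) where
  "X \<boxplus> Y =
     \<lparr>positions = positions X \<times> positions Y,
      moves = {((x, y), (x', y')). x \<in> positions X \<and> y \<in> positions Y \<and>
                 ((x, x') \<in> moves X \<and> y = y' \<or> x = x' \<and> (y, y') \<in> moves Y)}\<rparr>"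

definition sum_map :: "'a pregame \<Rightarrow> 'b pregame \<Rightarrow> ('a \<Rightarrow> 'c) \<Rightarrow> ('b \<Rightarrow> 'd) \<Rightarrow> 'a \<times> 'b \<Rightarrow> 'c \<times> 'd" where
  "sum_map X Y f g = restrict (\<lambda>(x, y). (f x, g y)) (positions (X \<boxplus> Y))"

definition unit_game :: "unit pregame" where
  "unit_game = \<lparr>positions = {()}, moves = {}\<rparr>"

definition assoc_map ::
    "'a pregame \<Rightarrow> 'b pregame \<Rightarrow> 'c pregame \<Rightarrow> ('a \<times> 'b) \<times> 'c \<Rightarrow> 'a \<times> ('b \<times> 'c)" where
  "assoc_map X Y Z = restrict (\<lambda>((x, y), z). (x, (y, z))) (positions ((X \<boxplus> Y) \<boxplus> Z))"

definition lunit_map :: "'a pregame \<Rightarrow> unit \<times> 'a \<Rightarrow> 'a" where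
  "lunit_map X = restrict snd (positions (unit_game \<boxplus> X))"

definition runit_map :: "'a pregame \<Rightarrow> 'a \<times> unit \<Rightarrow> 'a" where
  "runit_map X = restrict fst (positions (X \<boxplus> unit_game))"

definition swap_map :: "'a pregame \<Rightarrow> 'b pregame \<Rightarrow> 'a \<times> 'b \<Rightarrow> 'b \<times> 'a" where
  "swap_map X Y = restrict (\<lambda>(x, y). (y, x)) (positions (X \<boxplus> Y))"

section \<open>The internal hom\<close>

text \<open>
  Existence of a right adjoint to \<open>- \<boxplus> Y\<close> on games over all types cannot be expressed by an
  existential quantifier inside a HOL formula, because the adjoint must not depend on the type
  of the game being mapped into it.  It is therefore given explicitly.  A position of \<open>[Y, Z]\<close>
  is a function \<open>f\<close> from the positions of \<open>Y\<close> to those of \<open>Z\<close> together with a finite set \<open>S\<close> of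
  positions of \<open>[Y, Z]\<close>, its options.  The condition in \<open>hom_position\<close> says that
  evaluation \<open>(f, y) \<mapsto> f y\<close> preserves moves and lifts paths out of \<open>[Y, Z] \<boxplus> Y\<close>.
\<close>

datatype ('b, 'c) hom_tree =
  Hom_Node (hom_fun: "'b \<Rightarrow> 'c") (hom_succs: "('b, 'c) hom_tree fset")

inductive hom_position :: "'b pregame \<Rightarrow> 'c pregame \<Rightarrow> ('b, 'c) hom_tree \<Rightarrow> bool"
  for Y :: "'b pregame" and Z :: "'c pregame" where
  "\<lbrakk>f \<in> positions Y \<rightarrow>\<^sub>E positions Z;
    \<forall>t. t |\<in>| S \<longrightarrow> hom_position Y Z t;
    \<forall>y\<in>positions Y. {z. (f y, z) \<in> moves Z} =
       {f y' | y'. (y, y') \<in> moves Y} \<union> {hom_fun t y | t. t |\<in>| S}\<rbrakk>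
   \<Longrightarrow> hom_position Y Z (Hom_Node f S)"

definition hom_game :: "'b pregame \<Rightarrow> 'c pregame \<Rightarrow> ('b, 'c) hom_tree pregame" where
  "hom_game Y Z =
     \<lparr>positions = {t. hom_position Y Z t},
      moves = {(t, t'). hom_position Y Z t \<and> t' |\<in>| hom_succs t}\<rparr>"

primrec hom_tree_postcomp ::
    "'b pregame \<Rightarrow> ('c \<Rightarrow> 'd) \<Rightarrow> ('b, 'c) hom_tree \<Rightarrow> ('b, 'd) hom_tree" where
  "hom_tree_postcomp Y h (Hom_Node f S) =
     Hom_Node (compose (positions Y) h f) (hom_tree_postcomp Y h |`| S)"

definition hom_map ::
    "'b pregame \<Rightarrow> 'c pregame \<Rightarrow> ('c \<Rightarrow> 'd) \<Rightarrow> ('b, 'c) hom_tree \<Rightarrow> ('b, 'd) hom_tree" where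
  "hom_map Y Z h = restrict (hom_tree_postcomp Y h) (positions (hom_game Y Z))"

definition eval_map :: "'b pregame \<Rightarrow> 'c pregame \<Rightarrow> ('b, 'c) hom_tree \<times> 'b \<Rightarrow> 'c" where
  "eval_map Y Z = restrict (\<lambda>(t, y). hom_fun t y) (positions (hom_game Y Z \<boxplus> Y))"

definition uncurry_map ::
    "'a pregame \<Rightarrow> 'b pregame \<Rightarrow> 'c pregame \<Rightarrow> ('a \<Rightarrow> ('b, 'c) hom_tree) \<Rightarrow> 'a \<times> 'b \<Rightarrow> 'c" where
  "uncurry_map X Y Z g = (eval_map Y Z \<circ>\<^bsub>X \<boxplus> Y\<^esub> sum_map X Y g (game_id Y))"

end

theory Submission
  imports Defs
begin

text \<open>
  All structure maps are those of the cartesian product of sets, so the coherence laws hold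
  pointwise; only closedness needs an argument.  The condition on a position of \<open>[Y, Z]\<close> says
  exactly that evaluation is a game morphism.  Since \<open>X\<close> is well-founded and finitely branching,
  a morphism \<open>k\<close> from \<open>X \<boxplus> Y\<close> to \<open>Z\<close> determines, by recursion along the moves of \<open>X\<close>, a unique
  morphism to \<open>[Y, Z]\<close>: the tree at \<open>x\<close> carries the function \<open>k (x, -)\<close>, and, because a morphism
  preserves moves and lifts paths, its options must be the trees at the options of \<open>x\<close>.
\<close>

section \<open>Games and their morphisms\<close>

text \<open>Finite time is well-foundedness of the reversed move relation. This form provides
  induction and recursion along options, and lets lexicographic products be used for sums.\<close>

lemma game_iff_wf:
  "game X \<longleftrightarrow>
     moves X \<subseteq> positions X \<times> positions X \<and>
     (\<forall>x\<in>positions X. finite {x'. (x, x') \<in> moves X}) \<and>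
     wf ((moves X)\<inverse>)"
  unfolding game_def wf_iff_no_infinite_down_chain by simp

lemma game_wf: "game X \<Longrightarrow> wf ((moves X)\<inverse>)"
  by (simp add: game_iff_wf)

lemma game_moves_positions:
  assumes "game X" "(x, x') \<in> moves X"
  shows "x \<in> positions X" "x' \<in> positions X"
  using assms by (auto simp: game_def)

text \<open>Outside the positions there are no moves, so the option set is empty there. Finiteness
  at every point of the type is what allows \<open>Abs_fset\<close> in the recursion of
  \<open>curry_tree\<close>.\<close>

lemma finite_game_moves: "game X \<Longrightarrow> finite {x'. (x, x') \<in> moves X}"
  by (cases "x \<in> positions X") (auto simp: game_def intro: finite_subset[of _ "{}"])

lemma game_homI:
  assumes "f \<in> extensional (positions X)"
    and "\<And>x. x \<in> positions X \<Longrightarrow> f x \<in> positions Y"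
    and "\<And>x x'. (x, x') \<in> moves X \<Longrightarrow> (f x, f x') \<in> moves Y"
    and "\<And>x y. x \<in> positions X \<Longrightarrow> (f x, y) \<in> moves Y \<Longrightarrow> \<exists>x'. (x, x') \<in> moves X \<and> f x' = y"
  shows "f \<in> game_hom X Y"
  using assms by (auto simp: game_hom_def PiE_iff)

lemma game_hom_extensional: "f \<in> game_hom X Y \<Longrightarrow> f \<in> extensional (positions X)"
  by (auto simp: game_hom_def PiE_iff)

lemma game_hom_positions: "f \<in> game_hom X Y \<Longrightarrow> x \<in> positions X \<Longrightarrow> f x \<in> positions Y"
  by (auto simp: game_hom_def PiE_iff)

lemma game_hom_moves: "f \<in> game_hom X Y \<Longrightarrow> (x, x') \<in> moves X \<Longrightarrow> (f x, f x') \<in> moves Y"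
  by (auto simp: game_hom_def)

lemma game_hom_lift:
  assumes "f \<in> game_hom X Y" "x \<in> positions X" "(f x, y) \<in> moves Y"
  obtains x' where "(x, x') \<in> moves X" "f x' = y"
  using assms unfolding game_hom_def by blast

text \<open>Preservation of moves gives one inclusion and path-lifting the other. Morphisms are used
  in this form whenever option sets are compared.\<close>

lemma game_hom_image_moves:
  assumes "f \<in> game_hom X Y" "x \<in> positions X"
  shows "{y. (f x, y) \<in> moves Y} = f ` {x'. (x, x') \<in> moves X}"
  using assms by (auto simp: game_hom_moves elim: game_hom_lift)

lemma game_comp_extensional: "(g \<circ>\<^bsub>X\<^esub> f) \<in> extensional (positions X)"
  by (simp add: game_comp_def compose_def)

lemma game_comp_apply: "x \<in> positions X \<Longrightarrow> (g \<circ>\<^bsub>X\<^esub> f) x = g (f x)"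
  by (simp add: game_comp_def compose_def)

lemma game_id_apply: "x \<in> positions X \<Longrightarrow> game_id X x = x"
  by (simp add: game_id_def)

text \<open>If the inverse also preserves moves, path-lifting is automatic: a move from
  \<open>f x\<close> to \<open>y\<close> lifts to the move from \<open>x\<close> to
  \<open>g y\<close>. Both maps are taken unrestricted, so for a structure map only the formula of
  its inverse has to be supplied.\<close>

lemma game_iso_restrictI:
  assumes X: "game X" and Y: "game Y"
    and f: "\<And>x. x \<in> positions X \<Longrightarrow> f x \<in> positions Y"
    and g: "\<And>y. y \<in> positions Y \<Longrightarrow> g y \<in> positions X"
    and gf: "\<And>x. x \<in> positions X \<Longrightarrow> g (f x) = x"
    and fg: "\<And>y. y \<in> positions Y \<Longrightarrow> f (g y) = y"
    and mf: "\<And>x x'. (x, x') \<in> moves X \<Longrightarrow> (f x, f x') \<in> moves Y"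
    and mg: "\<And>y y'. (y, y') \<in> moves Y \<Longrightarrow> (g y, g y') \<in> moves X"
  shows "game_iso X Y (restrict f (positions X))"
proof -
  note pX = game_moves_positions[OF X] and pY = game_moves_positions[OF Y]
  have hom: "restrict f (positions X) \<in> game_hom X Y"
  proof (rule game_homI)
    fix x y assume x: "x \<in> positions X" and "(restrict f (positions X) x, y) \<in> moves Y"
    then have m: "(f x, y) \<in> moves Y" by simp
    then have "(x, g y) \<in> moves X" using mg[OF m] gf x by simp
    moreover have "f (g y) = y" using fg pY[OF m] by simp
    ultimately show "\<exists>x'. (x, x') \<in> moves X \<and> restrict f (positions X) x' = y"
      using pX by (metis restrict_apply')
  qed (use f mf pX in auto)
  have "restrict g (positions Y) \<in> game_hom Y X"
  proof (rule game_homI)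
    fix y x assume y: "y \<in> positions Y" and "(restrict g (positions Y) y, x) \<in> moves X"
    then have m: "(g y, x) \<in> moves X" by simp
    then have "(y, f x) \<in> moves Y" using mf[OF m] fg y by simp
    moreover have "g (f x) = x" using gf pX[OF m] by simp
    ultimately show "\<exists>y'. (y, y') \<in> moves Y \<and> restrict g (positions Y) y' = x"
      using pY by (metis restrict_apply')
  qed (use g mg pY in auto)
  moreover have "(restrict g (positions Y) \<circ>\<^bsub>X\<^esub> restrict f (positions X)) = game_id X"
    using f gf by (auto simp: fun_eq_iff game_comp_def compose_def game_id_def)
  moreover have "(restrict f (positions X) \<circ>\<^bsub>Y\<^esub> restrict g (positions Y)) = game_id Y"
    using g fg by (auto simp: fun_eq_iff game_comp_def compose_def game_id_def)
  ultimately show ?thesis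
    unfolding game_iso_def using hom by blast
qed

section \<open>The symmetric monoidal structure\<close>

lemma positions_conway_sum [simp]: "positions (X \<boxplus> Y) = positions X \<times> positions Y"
  by (simp add: conway_sum_def)

lemma moves_conway_sum:
  "((x, y), (x', y')) \<in> moves (X \<boxplus> Y) \<longleftrightarrow>
     x \<in> positions X \<and> y \<in> positions Y \<and>
     ((x, x') \<in> moves X \<and> y = y' \<or> x = x' \<and> (y, y') \<in> moves Y)"
  by (simp add: conway_sum_def)

lemma positions_unit_game [simp]: "positions unit_game = {()}"
  by (simp add: unit_game_def)

lemma moves_unit_game [simp]: "moves unit_game = {}"
  by (simp add: unit_game_def)

lemma game_unit_game: "game unit_game"
  by (simp add: game_def)

lemma game_conway_sum:
  fixes X :: "'a pregame" and Y :: "'b pregame"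
  assumes X: "game X" and Y: "game Y"
  shows "game (X \<boxplus> Y)"
  unfolding game_iff_wf
proof (intro conjI ballI)
  show "moves (X \<boxplus> Y) \<subseteq> positions (X \<boxplus> Y) \<times> positions (X \<boxplus> Y)"
    using game_moves_positions[OF X] game_moves_positions[OF Y] by (auto simp: moves_conway_sum)
next
  fix p :: "'a \<times> 'b"
  obtain x y where p: "p = (x, y)" by (cases p)
  have "{q. (p, q) \<in> moves (X \<boxplus> Y)} \<subseteq>
      (\<lambda>x'. (x', y)) ` {x'. (x, x') \<in> moves X} \<union> Pair x ` {y'. (y, y') \<in> moves Y}"
    by (auto simp: p moves_conway_sum)
  then show "finite {q. (p, q) \<in> moves (X \<boxplus> Y)}"
    by (rule finite_subset) (simp add: finite_game_moves X Y)
next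
  \<comment> \<open>A move either descends in \<open>X\<close>, or fixes the first coordinate and
    descends in \<open>Y\<close>, so the lexicographic order is a termination order for the
    sum.\<close>
  have "(moves (X \<boxplus> Y))\<inverse> \<subseteq> (moves X)\<inverse> <*lex*> (moves Y)\<inverse>"
    by (auto simp: moves_conway_sum)
  then show "wf ((moves (X \<boxplus> Y))\<inverse>)"
    using wf_lex_prod[OF game_wf[OF X] game_wf[OF Y]] by (rule wf_subset[rotated])
qed

section \<open>Functoriality of the Conway sum\<close>

lemma sum_map_extensional: "sum_map X Y f g \<in> extensional (positions X \<times> positions Y)"
  by (simp add: sum_map_def)

lemma sum_map_apply:
  "x \<in> positions X \<Longrightarrow> y \<in> positions Y \<Longrightarrow> sum_map X Y f g (x, y) = (f x, g y)"
  by (simp add: sum_map_def)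

text \<open>A move of a sum happens in one coordinate, the other being fixed. Both preservation and
  lifting therefore reduce to the morphism acting on the coordinate that moves.\<close>

lemma sum_map_hom:
  assumes X: "game X" and Y: "game Y" and f: "f \<in> game_hom X X'" and g: "g \<in> game_hom Y Y'"
  shows "sum_map X Y f g \<in> game_hom (X \<boxplus> Y) (X' \<boxplus> Y')"
proof -
  note pX = game_moves_positions[OF X] and pY = game_moves_positions[OF Y]
  show ?thesis
  proof (rule game_homI)
    show "sum_map X Y f g \<in> extensional (positions (X \<boxplus> Y))"
      by (simp add: sum_map_extensional)
    show "sum_map X Y f g p \<in> positions (X' \<boxplus> Y')" if "p \<in> positions (X \<boxplus> Y)" for p
      using that game_hom_positions[OF f] game_hom_positions[OF g] by (auto simp: sum_map_apply)
    show "(sum_map X Y f g p, sum_map X Y f g p') \<in> moves (X' \<boxplus> Y')"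
      if "(p, p') \<in> moves (X \<boxplus> Y)" for p p'
      using that game_hom_positions[OF f] game_hom_positions[OF g]
        game_hom_moves[OF f] game_hom_moves[OF g] pX pY
      by (cases p; cases p') (auto simp: sum_map_apply moves_conway_sum)
    show "\<exists>p'. (p, p') \<in> moves (X \<boxplus> Y) \<and> sum_map X Y f g p' = q"
      if p: "p \<in> positions (X \<boxplus> Y)" and m: "(sum_map X Y f g p, q) \<in> moves (X' \<boxplus> Y')" for p q
    proof -
      obtain x y x1 y1 where eq: "p = (x, y)" "q = (x1, y1)" by (cases p, cases q)
      have x: "x \<in> positions X" and y: "y \<in> positions Y" using p eq by auto
      have "(f x, x1) \<in> moves X' \<and> g y = y1 \<or> f x = x1 \<and> (g y, y1) \<in> moves Y'"
        using m x y by (simp add: eq sum_map_apply moves_conway_sum)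
      then show ?thesis
      proof
        assume a: "(f x, x1) \<in> moves X' \<and> g y = y1"
        then obtain x' where "(x, x') \<in> moves X" "f x' = x1"
          using game_hom_lift[OF f x] by metis
        then show ?thesis using a x y pX
          by (intro exI[of _ "(x', y)"]) (auto simp: eq moves_conway_sum sum_map_apply)
      next
        assume a: "f x = x1 \<and> (g y, y1) \<in> moves Y'"
        then obtain y' where "(y, y') \<in> moves Y" "g y' = y1"
          using game_hom_lift[OF g y] by metis
        then show ?thesis using a x y pY
          by (intro exI[of _ "(x, y')"]) (auto simp: eq moves_conway_sum sum_map_apply)
      qed
    qed
  qed
qed

lemma sum_map_id: "sum_map X Y (game_id X) (game_id Y) = game_id (X \<boxplus> Y)"
  by (auto simp: fun_eq_iff sum_map_def game_id_def)

lemma sum_map_comp: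
  assumes "f \<in> game_hom X X'" "g \<in> game_hom Y Y'"
  shows "sum_map X Y (f' \<circ>\<^bsub>X\<^esub> f) (g' \<circ>\<^bsub>Y\<^esub> g) =
    (sum_map X' Y' f' g' \<circ>\<^bsub>X \<boxplus> Y\<^esub> sum_map X Y f g)"
  using game_hom_positions[OF assms(1)] game_hom_positions[OF assms(2)]
  by (auto simp: fun_eq_iff sum_map_def game_comp_def compose_def)

section \<open>Associator, unitors and symmetry as isomorphisms\<close>

text \<open>Under either bracketing, a move is a move in one of the three coordinates with the other
  two fixed, so rebracketing preserves moves in both directions.\<close>

lemma assoc_map_iso:
  assumes "game X" "game Y" "game Z"
  shows "game_iso ((X \<boxplus> Y) \<boxplus> Z) (X \<boxplus> (Y \<boxplus> Z)) (assoc_map X Y Z)"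
  unfolding assoc_map_def
  by (rule game_iso_restrictI[where g = "\<lambda>(x, (y, z)). ((x, y), z)"])
    (use assms in \<open>auto simp: game_conway_sum moves_conway_sum\<close>)

lemma lunit_map_iso: "game X \<Longrightarrow> game_iso (unit_game \<boxplus> X) X (lunit_map X)"
  unfolding lunit_map_def
  by (rule game_iso_restrictI[where g = "Pair ()"])
    (auto simp: game_conway_sum game_unit_game moves_conway_sum dest: game_moves_positions)

lemma runit_map_iso: "game X \<Longrightarrow> game_iso (X \<boxplus> unit_game) X (runit_map X)"
  unfolding runit_map_def
  by (rule game_iso_restrictI[where g = "\<lambda>x. (x, ())"])
    (auto simp: game_conway_sum game_unit_game moves_conway_sum dest: game_moves_positions)

lemma swap_map_iso:
  assumes "game X" "game Y"
  shows "game_iso (X \<boxplus> Y) (Y \<boxplus> X) (swap_map X Y)"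
  unfolding swap_map_def
  by (rule game_iso_restrictI[where g = "\<lambda>(y, x). (x, y)"])
    (use assms in \<open>auto simp: game_conway_sum moves_conway_sum\<close>)

section \<open>Naturality and coherence equations\<close>

text \<open>After unfolding, the two sides of each equation are functions restricted to the same set
  of positions, and it remains to compare values there. Typing of the morphisms ensures that each
  inner value lies where the next restricted map is defined.\<close>

lemmas structure_map_defs =
  assoc_map_def lunit_map_def runit_map_def swap_map_def sum_map_def
  game_id_def game_comp_def compose_def

lemma assoc_map_natural:
  assumes "f \<in> game_hom X X'" "g \<in> game_hom Y Y'" "h \<in> game_hom Z Z'"
  shows "(assoc_map X' Y' Z' \<circ>\<^bsub>(X \<boxplus> Y) \<boxplus> Z\<^esub> sum_map (X \<boxplus> Y) Z (sum_map X Y f g) h) =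
    (sum_map X (Y \<boxplus> Z) f (sum_map Y Z g h) \<circ>\<^bsub>(X \<boxplus> Y) \<boxplus> Z\<^esub> assoc_map X Y Z)"
  using assms[THEN game_hom_positions] by (auto simp: fun_eq_iff structure_map_defs)

lemma lunit_map_natural:
  assumes "f \<in> game_hom X X'"
  shows "(lunit_map X' \<circ>\<^bsub>unit_game \<boxplus> X\<^esub> sum_map unit_game X (game_id unit_game) f) =
    (f \<circ>\<^bsub>unit_game \<boxplus> X\<^esub> lunit_map X)"
  using assms[THEN game_hom_positions] by (auto simp: fun_eq_iff structure_map_defs)

lemma runit_map_natural:
  assumes "f \<in> game_hom X X'"
  shows "(runit_map X' \<circ>\<^bsub>X \<boxplus> unit_game\<^esub> sum_map X unit_game f (game_id unit_game)) =
    (f \<circ>\<^bsub>X \<boxplus> unit_game\<^esub> runit_map X)"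
  using assms[THEN game_hom_positions] by (auto simp: fun_eq_iff structure_map_defs)

lemma swap_map_natural:
  assumes "f \<in> game_hom X X'" "g \<in> game_hom Y Y'"
  shows "(swap_map X' Y' \<circ>\<^bsub>X \<boxplus> Y\<^esub> sum_map X Y f g) =
    (sum_map Y X g f \<circ>\<^bsub>X \<boxplus> Y\<^esub> swap_map X Y)"
  using assms[THEN game_hom_positions] by (auto simp: fun_eq_iff structure_map_defs)

lemma pentagon:
  "(assoc_map W X (Y \<boxplus> Z) \<circ>\<^bsub>((W \<boxplus> X) \<boxplus> Y) \<boxplus> Z\<^esub> assoc_map (W \<boxplus> X) Y Z) =
    (sum_map W ((X \<boxplus> Y) \<boxplus> Z) (game_id W) (assoc_map X Y Z)
       \<circ>\<^bsub>((W \<boxplus> X) \<boxplus> Y) \<boxplus> Z\<^esub>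
     (assoc_map W (X \<boxplus> Y) Z
       \<circ>\<^bsub>((W \<boxplus> X) \<boxplus> Y) \<boxplus> Z\<^esub>
      sum_map ((W \<boxplus> X) \<boxplus> Y) Z (assoc_map W X Y) (game_id Z)))"
  by (auto simp: fun_eq_iff structure_map_defs)

lemma triangle:
  "(sum_map X (unit_game \<boxplus> Y) (game_id X) (lunit_map Y)
      \<circ>\<^bsub>(X \<boxplus> unit_game) \<boxplus> Y\<^esub> assoc_map X unit_game Y) =
    sum_map (X \<boxplus> unit_game) Y (runit_map X) (game_id Y)"
  by (auto simp: fun_eq_iff structure_map_defs)

text \<open>One hexagon suffices for a symmetry: the other follows from it by
  \<open>swap_map_swap_map\<close>.\<close>

lemma hexagon:
  "(assoc_map Y Z X
      \<circ>\<^bsub>(X \<boxplus> Y) \<boxplus> Z\<^esub> (swap_map X (Y \<boxplus> Z) \<circ>\<^bsub>(X \<boxplus> Y) \<boxplus> Z\<^esub> assoc_map X Y Z)) =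
    (sum_map Y (X \<boxplus> Z) (game_id Y) (swap_map X Z)
       \<circ>\<^bsub>(X \<boxplus> Y) \<boxplus> Z\<^esub>
     (assoc_map Y X Z \<circ>\<^bsub>(X \<boxplus> Y) \<boxplus> Z\<^esub> sum_map (X \<boxplus> Y) Z (swap_map X Y) (game_id Z)))"
  by (auto simp: fun_eq_iff structure_map_defs)

lemma swap_map_swap_map: "(swap_map Y X \<circ>\<^bsub>X \<boxplus> Y\<^esub> swap_map X Y) = game_id (X \<boxplus> Y)"
  by (auto simp: fun_eq_iff structure_map_defs)

lemma lunit_map_swap_map: "(lunit_map X \<circ>\<^bsub>X \<boxplus> unit_game\<^esub> swap_map X unit_game) = runit_map X"
  by (auto simp: fun_eq_iff structure_map_defs)

section \<open>The internal hom\<close>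

text \<open>The predicate has a single introduction rule, so the rule can be read as an equivalence,
  here in terms of the selectors. As \<open>hom_position\<close> recurs on the right, the
  equivalence is applied to a fixed tree or by a single substitution.\<close>

lemma hom_position_iff:
  "hom_position Y Z t \<longleftrightarrow>
     hom_fun t \<in> positions Y \<rightarrow>\<^sub>E positions Z \<and>
     (\<forall>t'. t' |\<in>| hom_succs t \<longrightarrow> hom_position Y Z t') \<and>
     (\<forall>y\<in>positions Y. {z. (hom_fun t y, z) \<in> moves Z} =
        {hom_fun t y' | y'. (y, y') \<in> moves Y} \<union> {hom_fun t' y | t'. t' |\<in>| hom_succs t})"
  by (cases t) (subst hom_position.simps, simp)

lemma positions_hom_game [simp]: "t \<in> positions (hom_game Y Z) \<longleftrightarrow> hom_position Y Z t"
  by (simp add: hom_game_def)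

lemma moves_hom_game [simp]:
  "(t, t') \<in> moves (hom_game Y Z) \<longleftrightarrow> hom_position Y Z t \<and> t' |\<in>| hom_succs t"
  by (simp add: hom_game_def)

lemma hom_position_succ: "hom_position Y Z t \<Longrightarrow> t' |\<in>| hom_succs t \<Longrightarrow> hom_position Y Z t'"
  by (simp add: hom_position_iff[of _ _ t])

lemma hom_position_fun: "hom_position Y Z t \<Longrightarrow> hom_fun t \<in> positions Y \<rightarrow>\<^sub>E positions Z"
  by (simp add: hom_position_iff[of _ _ t])

lemma hom_position_moves:
  assumes "hom_position Y Z t" "y \<in> positions Y"
  shows "(hom_fun t y, z) \<in> moves Z \<longleftrightarrow>
    (\<exists>y'. (y, y') \<in> moves Y \<and> z = hom_fun t y') \<or> (\<exists>t'. t' |\<in>| hom_succs t \<and> z = hom_fun t' y)"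
  using assms unfolding hom_position_iff[of _ _ t] by blast

text \<open>A move passes from a tree to one of its immediate subtrees. There are finitely many of
  these, and well-foundedness is structural induction on trees.\<close>

lemma game_hom_game: "game (hom_game Y Z)"
  unfolding game_iff_wf
proof (intro conjI ballI)
  show "moves (hom_game Y Z) \<subseteq> positions (hom_game Y Z) \<times> positions (hom_game Y Z)"
    by (auto intro: hom_position_succ)
  show "finite {t'. (t, t') \<in> moves (hom_game Y Z)}" for t
    by (rule finite_subset[of _ "fset (hom_succs t)"]) auto
  show "wf ((moves (hom_game Y Z))\<inverse>)"
  proof (rule wfUNIVI)
    fix P and t :: "('a, 'b) hom_tree"
    assume step: "\<forall>t. (\<forall>t'. (t', t) \<in> (moves (hom_game Y Z))\<inverse> \<longrightarrow> P t') \<longrightarrow> P t"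
    show "P t"
      by (induction t) (rule step[rule_format], simp)
  qed
qed

section \<open>Postcomposition and the functor [Y, -]\<close>

lemma hom_fun_postcomp [simp]:
  "hom_fun (hom_tree_postcomp Y h t) = compose (positions Y) h (hom_fun t)"
  by (cases t) simp

lemma hom_succs_postcomp [simp]:
  "hom_succs (hom_tree_postcomp Y h t) = hom_tree_postcomp Y h |`| hom_succs t"
  by (cases t) simp

text \<open>Since \<open>h\<close> is a morphism, the options of \<open>h (f y)\<close> are the
  images of the options of \<open>f y\<close>. Applying \<open>h\<close> to the equation at each
  node thus yields the equation for the new tree; the subtrees are covered by induction.\<close>

lemma hom_position_postcomp:
  assumes Y: "game Y" and h: "h \<in> game_hom Z Z'" and t: "hom_position Y Z t"
  shows "hom_position Y Z' (hom_tree_postcomp Y h t)"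
  using t
proof (induction t rule: hom_tree.induct)
  case (Hom_Node f S)
  let ?t = "Hom_Node f S"
  have f: "f y \<in> positions Z" if "y \<in> positions Y" for y
    using hom_position_fun[OF Hom_Node.prems] that by auto
  have succ: "hom_position Y Z t" if "t |\<in>| S" for t
    using hom_position_succ[OF Hom_Node.prems] that by simp
  have "{z. (h (f y), z) \<in> moves Z'} =
      {compose (positions Y) h f y' | y'. (y, y') \<in> moves Y} \<union>
      {hom_fun t y | t. t |\<in>| hom_tree_postcomp Y h |`| S}" if y: "y \<in> positions Y" for y
  proof -
    have "{z. (h (f y), z) \<in> moves Z'} = h ` {z. (f y, z) \<in> moves Z}"
      by (rule game_hom_image_moves[OF h f[OF y]])
    also have "\<dots> = {h (f y') | y'. (y, y') \<in> moves Y} \<union> {h (hom_fun t y) | t. t |\<in>| S}"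
      using hom_position_moves[OF Hom_Node.prems y] by auto
    \<comment> \<open>Options \<open>y'\<close> of \<open>y\<close> are positions because
      \<open>Y\<close> is a game, so the restriction in \<open>compose\<close> has no effect at
      them.\<close>
    also have "\<dots> = {compose (positions Y) h f y' | y'. (y, y') \<in> moves Y} \<union>
        {hom_fun t y | t. t |\<in>| hom_tree_postcomp Y h |`| S}"
      using y game_moves_positions[OF Y]
      by (auto simp: Setcompr_eq_image image_image compose_def)
    finally show ?thesis .
  qed
  moreover have "compose (positions Y) h f \<in> positions Y \<rightarrow>\<^sub>E positions Z'"
    using f game_hom_positions[OF h] by (auto simp: compose_def)
  ultimately show ?case
    using Hom_Node.IH succ
    by (subst hom_position_iff) (auto simp: compose_eq)
qed

lemma hom_map_apply: "hom_position Y Z t \<Longrightarrow> hom_map Y Z h t = hom_tree_postcomp Y h t"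
  by (simp add: hom_map_def)

text \<open>Postcomposition maps the options of a tree onto the options of its image, which gives
  preservation and lifting at once.\<close>

lemma hom_map_hom:
  assumes "game Y" "h \<in> game_hom Z Z'"
  shows "hom_map Y Z h \<in> game_hom (hom_game Y Z) (hom_game Y Z')"
proof (rule game_homI)
  show "hom_map Y Z h \<in> extensional (positions (hom_game Y Z))"
    by (simp add: hom_map_def)
qed (use hom_position_postcomp[OF assms] hom_position_succ in
      \<open>fastforce simp: hom_map_apply\<close>)+

text \<open>Every function stored in a position is extensional with values in
  \<open>positions Z\<close>, so composing with the restricted identity leaves it unchanged.\<close>

lemma hom_tree_postcomp_id:
  "hom_position Y Z t \<Longrightarrow> hom_tree_postcomp Y (game_id Z) t = t"
proof (induction t)
  case (Hom_Node f S)
  have "compose (positions Y) (game_id Z) f = f"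
    using hom_position_fun[OF Hom_Node.prems]
    by (auto simp: fun_eq_iff compose_def game_id_def PiE_iff extensional_def)
  moreover have "hom_tree_postcomp Y (game_id Z) |`| S = S"
    using Hom_Node.IH hom_position_succ[OF Hom_Node.prems] by (force simp: fset_eq_iff)
  ultimately show ?case by simp
qed

lemma hom_map_id: "hom_map Y Z (game_id Z) = game_id (hom_game Y Z)"
  by (auto simp: fun_eq_iff hom_map_def game_id_def hom_tree_postcomp_id[unfolded game_id_def])

lemma hom_tree_postcomp_comp:
  "hom_position Y Z t \<Longrightarrow>
    hom_tree_postcomp Y (h' \<circ>\<^bsub>Z\<^esub> h) t = hom_tree_postcomp Y h' (hom_tree_postcomp Y h t)"
proof (induction t)
  case (Hom_Node f S)
  have "compose (positions Y) (h' \<circ>\<^bsub>Z\<^esub> h) f = compose (positions Y) h' (compose (positions Y) h f)"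
    using hom_position_fun[OF Hom_Node.prems]
    by (auto simp: fun_eq_iff compose_def game_comp_def)
  moreover have "hom_tree_postcomp Y (h' \<circ>\<^bsub>Z\<^esub> h) |`| S =
      hom_tree_postcomp Y h' |`| (hom_tree_postcomp Y h |`| S)"
    using Hom_Node.IH hom_position_succ[OF Hom_Node.prems]
    by (auto simp: fset.map_comp intro!: fset.map_cong0)
  ultimately show ?case by simp
qed

lemma hom_map_comp:
  assumes "game Y" "h \<in> game_hom Z Z'"
  shows "hom_map Y Z (h' \<circ>\<^bsub>Z\<^esub> h) = (hom_map Y Z' h' \<circ>\<^bsub>hom_game Y Z\<^esub> hom_map Y Z h)"
  using hom_position_postcomp[OF assms]
  \<comment> \<open>Only the composite over \<open>hom_game Y Z\<close> is unfolded; the composite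
    of \<open>h'\<close> and \<open>h\<close> stays folded so that
    \<open>hom_tree_postcomp_comp\<close> matches.\<close>
  by (auto simp: fun_eq_iff hom_map_def game_comp_def[of _ "hom_game Y Z"] compose_def
      hom_tree_postcomp_comp)

section \<open>The adjunction\<close>

lemma eval_map_apply:
  "hom_position Y Z t \<Longrightarrow> y \<in> positions Y \<Longrightarrow> eval_map Y Z (t, y) = hom_fun t y"
  by (simp add: eval_map_def)

text \<open>The set equation in \<open>hom_position\<close> splits into the two halves of the claim:
  its right side lies in the left by preservation of moves, and its left side in the right by
  path-lifting.\<close>

lemma eval_map_hom:
  assumes Y: "game Y"
  shows "eval_map Y Z \<in> game_hom (hom_game Y Z \<boxplus> Y) Z"
proof (rule game_homI)
  show "eval_map Y Z \<in> extensional (positions (hom_game Y Z \<boxplus> Y))"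
    by (simp add: eval_map_def)
  show "eval_map Y Z p \<in> positions Z" if "p \<in> positions (hom_game Y Z \<boxplus> Y)" for p
    using that hom_position_fun by (fastforce simp: eval_map_apply)
  show "(eval_map Y Z p, eval_map Y Z p') \<in> moves Z"
    if "(p, p') \<in> moves (hom_game Y Z \<boxplus> Y)" for p p'
    using that game_moves_positions[OF Y]
    by (cases p; cases p')
      (auto simp: moves_conway_sum eval_map_apply hom_position_moves hom_position_succ)
  show "\<exists>p'. (p, p') \<in> moves (hom_game Y Z \<boxplus> Y) \<and> eval_map Y Z p' = z"
    if p: "p \<in> positions (hom_game Y Z \<boxplus> Y)" and m: "(eval_map Y Z p, z) \<in> moves Z" for p z
  proof -
    obtain t y where eq: "p = (t, y)" by (cases p)
    have t: "hom_position Y Z t" and y: "y \<in> positions Y" using p eq by auto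
    have "(hom_fun t y, z) \<in> moves Z" using m t y by (simp add: eq eval_map_apply)
    then consider y' where "(y, y') \<in> moves Y" "z = hom_fun t y'"
      | t' where "t' |\<in>| hom_succs t" "z = hom_fun t' y"
      using hom_position_moves[OF t y] by blast
    then show ?thesis
    proof cases
      case 1
      then show ?thesis using t y game_moves_positions[OF Y]
        by (intro exI[of _ "(t, y')"]) (auto simp: eq moves_conway_sum eval_map_apply)
    next
      case 2
      then show ?thesis using t y hom_position_succ[OF t]
        by (intro exI[of _ "(t', y)"]) (auto simp: eq moves_conway_sum eval_map_apply)
    qed
  qed
qed

section \<open>Uncurrying and its injectivity\<close>

lemma uncurry_map_extensional: "uncurry_map X Y Z g \<in> extensional (positions X \<times> positions Y)"
  using game_comp_extensional[of _ "X \<boxplus> Y"] by (simp add: uncurry_map_def)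

lemma uncurry_map_apply:
  assumes "g \<in> game_hom X (hom_game Y Z)" "x \<in> positions X" "y \<in> positions Y"
  shows "uncurry_map X Y Z g (x, y) = hom_fun (g x) y"
  using assms game_hom_positions[OF assms(1,2)]
  by (simp add: uncurry_map_def game_comp_apply sum_map_apply game_id_apply eval_map_apply)

lemma uncurry_map_hom:
  assumes "game X" "game Y" "g \<in> game_hom X (hom_game Y Z)"
  shows "uncurry_map X Y Z g \<in> game_hom (X \<boxplus> Y) Z"
  unfolding uncurry_map_def
  by (rule game_comp_hom[OF game_conway_sum sum_map_hom eval_map_hom])
    (use assms game_id_hom in auto)

text \<open>The moves out of a position of \<open>hom_game Y Z\<close> are its stored options, so
  preservation and lifting fix the options of \<open>g x\<close> once \<open>g\<close> is known on
  the options of \<open>x\<close>. Uniqueness of the transpose rests on this.\<close>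

lemma hom_succs_game_hom:
  assumes "g \<in> game_hom X (hom_game Y Z)" "x \<in> positions X"
  shows "fset (hom_succs (g x)) = g ` {x'. (x, x') \<in> moves X}"
  using game_hom_image_moves[OF assms] game_hom_positions[OF assms] by simp

lemma inj_on_uncurry_map:
  assumes X: "game X"
  shows "inj_on (uncurry_map X Y Z) (game_hom X (hom_game Y Z))"
proof (rule inj_onI)
  fix g g' assume g: "g \<in> game_hom X (hom_game Y Z)" and g': "g' \<in> game_hom X (hom_game Y Z)"
    and eq: "uncurry_map X Y Z g = uncurry_map X Y Z g'"
  \<comment> \<open>Induction along the moves of \<open>X\<close>: the function at the node is read
    off from the uncurried map at \<open>(x, y)\<close>, and the options agree by the induction
    hypothesis. Together they determine the tree.\<close>
  have "x \<in> positions X \<longrightarrow> g x = g' x" for x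
  proof (induction x rule: wf_induct_rule[OF game_wf[OF X]])
    case (1 x)
    show ?case
    proof
      assume x: "x \<in> positions X"
      have "hom_fun (g x) y = hom_fun (g' x) y" if "y \<in> positions Y" for y
        using uncurry_map_apply[OF g x that] uncurry_map_apply[OF g' x that] eq by simp
      moreover have "hom_fun (g x) \<in> extensional (positions Y)"
        "hom_fun (g' x) \<in> extensional (positions Y)"
        using hom_position_fun game_hom_positions[OF g x] game_hom_positions[OF g' x]
        by (auto simp: PiE_iff)
      ultimately have "hom_fun (g x) = hom_fun (g' x)"
        by (metis extensionalityI)
      moreover have "fset (hom_succs (g x)) = fset (hom_succs (g' x))"
        unfolding hom_succs_game_hom[OF g x] hom_succs_game_hom[OF g' x]
        using 1 game_moves_positions[OF X] by (intro image_cong) auto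
      ultimately show "g x = g' x"
        by (simp add: hom_tree.expand fset_inject)
    qed
  qed
  then show "g = g'"
    using game_hom_extensional[OF g] game_hom_extensional[OF g'] by (metis extensionalityI)
qed

section \<open>Currying by recursion along moves\<close>

text \<open>The recursion is along a relation that is well-founded only when \<open>X\<close> is a
  game, hence \<open>wfrec\<close> with an unfolding law proved under that hypothesis. It is total
  on the type and gets restricted to positions later.\<close>

definition curry_tree ::
    "'a pregame \<Rightarrow> 'b pregame \<Rightarrow> ('a \<times> 'b \<Rightarrow> 'c) \<Rightarrow> 'a \<Rightarrow> ('b, 'c) hom_tree" where
  "curry_tree X Y k =
     wfrec ((moves X)\<inverse>)
       (\<lambda>c x. Hom_Node (\<lambda>y\<in>positions Y. k (x, y)) (Abs_fset (c ` {x'. (x, x') \<in> moves X})))"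

lemma curry_tree_unfold:
  assumes "game X"
  shows "hom_fun (curry_tree X Y k x) = (\<lambda>y\<in>positions Y. k (x, y))"
    and "fset (hom_succs (curry_tree X Y k x)) = curry_tree X Y k ` {x'. (x, x') \<in> moves X}"
proof -
  have "curry_tree X Y k x = Hom_Node (\<lambda>y\<in>positions Y. k (x, y))
      (Abs_fset (cut (curry_tree X Y k) ((moves X)\<inverse>) x ` {x'. (x, x') \<in> moves X}))"
    unfolding curry_tree_def by (subst wfrec[OF game_wf[OF assms]]) simp
  \<comment> \<open>Recursive calls occur only at options of \<open>x\<close>, which are below
    \<open>x\<close>, so \<open>cut\<close> changes nothing.\<close>
  moreover have "cut (curry_tree X Y k) ((moves X)\<inverse>) x ` {x'. (x, x') \<in> moves X} =
      curry_tree X Y k ` {x'. (x, x') \<in> moves X}"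
    by (intro image_cong) (simp_all add: cut_apply)
  ultimately have "curry_tree X Y k x = Hom_Node (\<lambda>y\<in>positions Y. k (x, y))
      (Abs_fset (curry_tree X Y k ` {x'. (x, x') \<in> moves X}))"
    by simp
  then show "hom_fun (curry_tree X Y k x) = (\<lambda>y\<in>positions Y. k (x, y))"
    "fset (hom_succs (curry_tree X Y k x)) = curry_tree X Y k ` {x'. (x, x') \<in> moves X}"
    by (simp_all add: Abs_fset_inverse finite_game_moves[OF assms])
qed

lemma hom_position_curry_tree:
  assumes X: "game X" and Y: "game Y" and k: "k \<in> game_hom (X \<boxplus> Y) Z"
    and x: "x \<in> positions X"
  shows "hom_position Y Z (curry_tree X Y k x)"
  using x
proof (induction x rule: wf_induct_rule[OF game_wf[OF X]])
  case (1 x)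
  note pX = game_moves_positions[OF X] and pY = game_moves_positions[OF Y]
  have "{z. (k (x, y), z) \<in> moves Z} =
      {hom_fun (curry_tree X Y k x) y' | y'. (y, y') \<in> moves Y} \<union>
      {hom_fun t y | t. t |\<in>| hom_succs (curry_tree X Y k x)}" if y: "y \<in> positions Y" for y
  proof -
    have "{z. (k (x, y), z) \<in> moves Z} = k ` {p. ((x, y), p) \<in> moves (X \<boxplus> Y)}"
      using game_hom_image_moves[OF k, of "(x, y)"] 1 y by simp
    \<comment> \<open>A move out of \<open>(x, y)\<close> is made in \<open>Y\<close> or in
      \<open>X\<close>. The first kind yields the values of the function at \<open>x\<close>, the
      second the values at \<open>y\<close> of the functions in its options.\<close>
    also have "{p. ((x, y), p) \<in> moves (X \<boxplus> Y)} =
        Pair x ` {y'. (y, y') \<in> moves Y} \<union> (\<lambda>x'. (x', y)) ` {x'. (x, x') \<in> moves X}"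
      using 1 y by (auto simp: moves_conway_sum)
    also have "k ` \<dots> = (\<lambda>y'. k (x, y')) ` {y'. (y, y') \<in> moves Y} \<union>
        (\<lambda>x'. k (x', y)) ` {x'. (x, x') \<in> moves X}"
      by (simp add: image_Un image_image)
    also have "(\<lambda>y'. k (x, y')) ` {y'. (y, y') \<in> moves Y} =
        {hom_fun (curry_tree X Y k x) y' | y'. (y, y') \<in> moves Y}"
      using pY by (auto simp: curry_tree_unfold(1)[OF X])
    also have "(\<lambda>x'. k (x', y)) ` {x'. (x, x') \<in> moves X} =
        {hom_fun t y | t. t |\<in>| hom_succs (curry_tree X Y k x)}"
      using y by (simp add: Setcompr_eq_image image_image curry_tree_unfold[OF X])
    finally show ?thesis .
  qed
  moreover have "hom_fun (curry_tree X Y k x) \<in> positions Y \<rightarrow>\<^sub>E positions Z"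
    using game_hom_positions[OF k] 1 by (auto simp: curry_tree_unfold(1)[OF X])
  moreover have "hom_position Y Z t" if "t |\<in>| hom_succs (curry_tree X Y k x)" for t
    using that 1 pX by (auto simp: curry_tree_unfold(2)[OF X])
  ultimately show ?case
    by (subst hom_position_iff) (simp add: curry_tree_unfold(1)[OF X, of _ _ x])
qed

text \<open>By construction the options of the tree at \<open>x\<close> are the trees at the options
  of \<open>x\<close>, which is both preservation and lifting.\<close>

lemma curry_tree_hom:
  assumes X: "game X" and Y: "game Y" and k: "k \<in> game_hom (X \<boxplus> Y) Z"
  shows "restrict (curry_tree X Y k) (positions X) \<in> game_hom X (hom_game Y Z)"
proof (rule game_homI)
  note pX = game_moves_positions[OF X] and pos = hom_position_curry_tree[OF assms]
  let ?c = "restrict (curry_tree X Y k) (positions X)"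
  show "?c x \<in> positions (hom_game Y Z)" if "x \<in> positions X" for x
    using that pos by simp
  show "(?c x, ?c x') \<in> moves (hom_game Y Z)" if "(x, x') \<in> moves X" for x x'
    using that pX[OF that] pos by (auto simp: curry_tree_unfold(2)[OF X])
  show "\<exists>x'. (x, x') \<in> moves X \<and> ?c x' = t"
    if "x \<in> positions X" "(?c x, t) \<in> moves (hom_game Y Z)" for x t
    using that pX by (auto simp: curry_tree_unfold(2)[OF X])
qed simp

section \<open>The hom-set bijection and its naturality\<close>

lemma bij_betw_uncurry_map:
  assumes X: "game X" and Y: "game Y"
  shows "bij_betw (uncurry_map X Y Z) (game_hom X (hom_game Y Z)) (game_hom (X \<boxplus> Y) Z)"
  unfolding bij_betw_def
proof (intro conjI subset_antisym)
  show "inj_on (uncurry_map X Y Z) (game_hom X (hom_game Y Z))"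
    by (rule inj_on_uncurry_map[OF X])
  show "uncurry_map X Y Z ` game_hom X (hom_game Y Z) \<subseteq> game_hom (X \<boxplus> Y) Z"
    using uncurry_map_hom[OF X Y] by blast
  show "game_hom (X \<boxplus> Y) Z \<subseteq> uncurry_map X Y Z ` game_hom X (hom_game Y Z)"
  proof
    fix k assume k: "k \<in> game_hom (X \<boxplus> Y) Z"
    \<comment> \<open>The curried tree stores \<open>k (x, -)\<close> at \<open>x\<close>, so
      evaluating it at \<open>y\<close> returns \<open>k (x, y)\<close>; off the product both sides
      are undefined by extensionality.\<close>
    have "uncurry_map X Y Z (restrict (curry_tree X Y k) (positions X)) = k"
    proof (rule extensionalityI)
      show "uncurry_map X Y Z (restrict (curry_tree X Y k) (positions X)) p = k p"
        if "p \<in> positions X \<times> positions Y" for p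
        using that
        by (auto simp: uncurry_map_apply[OF curry_tree_hom[OF X Y k]] curry_tree_unfold(1)[OF X])
    qed (use uncurry_map_extensional game_hom_extensional[OF k] in auto)
    then show "k \<in> uncurry_map X Y Z ` game_hom X (hom_game Y Z)"
      using curry_tree_hom[OF X Y k] by (metis image_eqI)
  qed
qed

text \<open>At \<open>(x, y)\<close> both sides evaluate to
  \<open>hom_fun (g (k x)) y\<close>.\<close>

lemma uncurry_map_natural_domain:
  assumes X: "game X" and k: "k \<in> game_hom X X'" and g: "g \<in> game_hom X' (hom_game Y Z)"
  shows "uncurry_map X Y Z (g \<circ>\<^bsub>X\<^esub> k) =
    (uncurry_map X' Y Z g \<circ>\<^bsub>X \<boxplus> Y\<^esub> sum_map X Y k (game_id Y))"
proof (rule extensionalityI)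
  show "uncurry_map X Y Z (g \<circ>\<^bsub>X\<^esub> k) p =
      (uncurry_map X' Y Z g \<circ>\<^bsub>X \<boxplus> Y\<^esub> sum_map X Y k (game_id Y)) p"
    if "p \<in> positions (X \<boxplus> Y)" for p
    using that game_hom_positions[OF k]
    by (auto simp: game_comp_apply sum_map_apply game_id_apply uncurry_map_apply[OF g]
        uncurry_map_apply[OF game_comp_hom[OF X k g]])
qed (use uncurry_map_extensional game_comp_extensional[of _ "X \<boxplus> Y"] in auto)

text \<open>At \<open>(x, y)\<close> both sides evaluate to \<open>h (hom_fun (g x) y)\<close>,
  since postcomposition applies \<open>h\<close> to the function stored at the root.\<close>

lemma uncurry_map_natural_codomain:
  assumes X: "game X" and Y: "game Y"
    and h: "h \<in> game_hom Z Z'" and g: "g \<in> game_hom X (hom_game Y Z)"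
  shows "uncurry_map X Y Z' (hom_map Y Z h \<circ>\<^bsub>X\<^esub> g) = (h \<circ>\<^bsub>X \<boxplus> Y\<^esub> uncurry_map X Y Z g)"
proof (rule extensionalityI)
  show "uncurry_map X Y Z' (hom_map Y Z h \<circ>\<^bsub>X\<^esub> g) p = (h \<circ>\<^bsub>X \<boxplus> Y\<^esub> uncurry_map X Y Z g) p"
    if "p \<in> positions (X \<boxplus> Y)" for p
    using that game_hom_positions[OF g]
    by (auto simp: game_comp_apply uncurry_map_apply[OF g] hom_map_apply compose_eq
        uncurry_map_apply[OF game_comp_hom[OF X g hom_map_hom[OF Y h]]])
qed (use uncurry_map_extensional game_comp_extensional[of _ "X \<boxplus> Y"] in auto)

theorem proposition4p2:
  fixes W :: "'w pregame"
    and X :: "'x pregame" and X' :: "'x1 pregame" and X'' :: "'x2 pregame"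
    and Y :: "'y pregame" and Y' :: "'y1 pregame" and Y'' :: "'y2 pregame"
    and Z :: "'z pregame" and Z' :: "'z1 pregame" and Z'' :: "'z2 pregame"
  assumes "game W" "game X" "game X'" "game X''" "game Y" "game Y'" "game Y''"
    "game Z" "game Z'" "game Z''"
  (* In the order of the conjuncts: bifunctor and unit object; isomorphisms; their naturality;
     pentagon; triangle; hexagon; symmetry law and its compatibility with the unitors;
     functor [Y, -]; its adjunction with - + Y. *)
  shows
    "game (X \<boxplus> Y) \<and>
     (\<forall>f\<in>game_hom X X'. \<forall>g\<in>game_hom Y Y'.
        sum_map X Y f g \<in> game_hom (X \<boxplus> Y) (X' \<boxplus> Y')) \<and>
     sum_map X Y (game_id X) (game_id Y) = game_id (X \<boxplus> Y) \<and>
     (\<forall>f\<in>game_hom X X'. \<forall>f'\<in>game_hom X' X''. \<forall>g\<in>game_hom Y Y'. \<forall>g'\<in>game_hom Y' Y''.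
        sum_map X Y (f' \<circ>\<^bsub>X\<^esub> f) (g' \<circ>\<^bsub>Y\<^esub> g) =
        sum_map X' Y' f' g' \<circ>\<^bsub>X \<boxplus> Y\<^esub> sum_map X Y f g) \<and>
     game unit_game \<and>

     game_iso ((X \<boxplus> Y) \<boxplus> Z) (X \<boxplus> (Y \<boxplus> Z)) (assoc_map X Y Z) \<and>
     game_iso (unit_game \<boxplus> X) X (lunit_map X) \<and>
     game_iso (X \<boxplus> unit_game) X (runit_map X) \<and>
     game_iso (X \<boxplus> Y) (Y \<boxplus> X) (swap_map X Y) \<and>

     (\<forall>f\<in>game_hom X X'. \<forall>g\<in>game_hom Y Y'. \<forall>h\<in>game_hom Z Z'.
        assoc_map X' Y' Z' \<circ>\<^bsub>(X \<boxplus> Y) \<boxplus> Z\<^esub> sum_map (X \<boxplus> Y) Z (sum_map X Y f g) h =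
        sum_map X (Y \<boxplus> Z) f (sum_map Y Z g h) \<circ>\<^bsub>(X \<boxplus> Y) \<boxplus> Z\<^esub> assoc_map X Y Z) \<and>
     (\<forall>f\<in>game_hom X X'.
        lunit_map X' \<circ>\<^bsub>unit_game \<boxplus> X\<^esub> sum_map unit_game X (game_id unit_game) f =
        f \<circ>\<^bsub>unit_game \<boxplus> X\<^esub> lunit_map X) \<and>
     (\<forall>f\<in>game_hom X X'.
        runit_map X' \<circ>\<^bsub>X \<boxplus> unit_game\<^esub> sum_map X unit_game f (game_id unit_game) =
        f \<circ>\<^bsub>X \<boxplus> unit_game\<^esub> runit_map X) \<and>
     (\<forall>f\<in>game_hom X X'. \<forall>g\<in>game_hom Y Y'.
        swap_map X' Y' \<circ>\<^bsub>X \<boxplus> Y\<^esub> sum_map X Y f g =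
        sum_map Y X g f \<circ>\<^bsub>X \<boxplus> Y\<^esub> swap_map X Y) \<and>

     assoc_map W X (Y \<boxplus> Z) \<circ>\<^bsub>((W \<boxplus> X) \<boxplus> Y) \<boxplus> Z\<^esub> assoc_map (W \<boxplus> X) Y Z =
       sum_map W ((X \<boxplus> Y) \<boxplus> Z) (game_id W) (assoc_map X Y Z)
         \<circ>\<^bsub>((W \<boxplus> X) \<boxplus> Y) \<boxplus> Z\<^esub>
       (assoc_map W (X \<boxplus> Y) Z
         \<circ>\<^bsub>((W \<boxplus> X) \<boxplus> Y) \<boxplus> Z\<^esub>
        sum_map ((W \<boxplus> X) \<boxplus> Y) Z (assoc_map W X Y) (game_id Z)) \<and>

     sum_map X (unit_game \<boxplus> Y) (game_id X) (lunit_map Y)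
         \<circ>\<^bsub>(X \<boxplus> unit_game) \<boxplus> Y\<^esub> assoc_map X unit_game Y =
       sum_map (X \<boxplus> unit_game) Y (runit_map X) (game_id Y) \<and>

     assoc_map Y Z X \<circ>\<^bsub>(X \<boxplus> Y) \<boxplus> Z\<^esub> (swap_map X (Y \<boxplus> Z) \<circ>\<^bsub>(X \<boxplus> Y) \<boxplus> Z\<^esub> assoc_map X Y Z) =
       sum_map Y (X \<boxplus> Z) (game_id Y) (swap_map X Z)
         \<circ>\<^bsub>(X \<boxplus> Y) \<boxplus> Z\<^esub>
       (assoc_map Y X Z \<circ>\<^bsub>(X \<boxplus> Y) \<boxplus> Z\<^esub> sum_map (X \<boxplus> Y) Z (swap_map X Y) (game_id Z)) \<and>

     swap_map Y X \<circ>\<^bsub>X \<boxplus> Y\<^esub> swap_map X Y = game_id (X \<boxplus> Y) \<and>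
     lunit_map X \<circ>\<^bsub>X \<boxplus> unit_game\<^esub> swap_map X unit_game = runit_map X \<and>

     game (hom_game Y Z) \<and>
     (\<forall>h\<in>game_hom Z Z'. hom_map Y Z h \<in> game_hom (hom_game Y Z) (hom_game Y Z')) \<and>
     hom_map Y Z (game_id Z) = game_id (hom_game Y Z) \<and>
     (\<forall>h\<in>game_hom Z Z'. \<forall>h'\<in>game_hom Z' Z''.
        hom_map Y Z (h' \<circ>\<^bsub>Z\<^esub> h) = hom_map Y Z' h' \<circ>\<^bsub>hom_game Y Z\<^esub> hom_map Y Z h) \<and>

     eval_map Y Z \<in> game_hom (hom_game Y Z \<boxplus> Y) Z \<and>
     bij_betw (uncurry_map X Y Z) (game_hom X (hom_game Y Z)) (game_hom (X \<boxplus> Y) Z) \<and>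
     (\<forall>k\<in>game_hom X X'. \<forall>g\<in>game_hom X' (hom_game Y Z).
        uncurry_map X Y Z (g \<circ>\<^bsub>X\<^esub> k) =
        uncurry_map X' Y Z g \<circ>\<^bsub>X \<boxplus> Y\<^esub> sum_map X Y k (game_id Y)) \<and>
     (\<forall>h\<in>game_hom Z Z'. \<forall>g\<in>game_hom X (hom_game Y Z).
        uncurry_map X Y Z' (hom_map Y Z h \<circ>\<^bsub>X\<^esub> g) = h \<circ>\<^bsub>X \<boxplus> Y\<^esub> uncurry_map X Y Z g)"
  using assms
  by (intro conjI ballI game_conway_sum sum_map_hom sum_map_id sum_map_comp game_unit_game
      assoc_map_iso lunit_map_iso runit_map_iso swap_map_iso assoc_map_natural
      lunit_map_natural runit_map_natural swap_map_natural pentagon triangle hexagon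
      swap_map_swap_map lunit_map_swap_map game_hom_game hom_map_hom hom_map_id hom_map_comp
      eval_map_hom bij_betw_uncurry_map uncurry_map_natural_domain uncurry_map_natural_codomain)

end
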